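(* Let $G$ be an arbitrary loop-free $d$-regular graph on $n$ vertices. For an arbitrary graph $H$ and an arbitrary bipartite graph $B$, $$\hom(G, l(H^B)) \leq \hom(K_{d+1}, l(H^B))^{\frac{n}{d+1}}.$$
   Context: All graphs are finite and undirected, without multiple edges, but may have loops unless stated otherwise; bipartite graphs have no loops. A homomorphism from $G$ to $H$ is a map $\phi:V(G)\to V(H)$ such that $\phi(u)\phi(v)\in E(H)$ for every edge (including loops) $uv\in E(G)$; $\hom(G,H)$ is the number of homomorphisms from $G$ to $H$. $K_{d+1}$ is the complete loop-free graph on $d+1$ vertices. Graph exponentiation: $H^B$ is the graph whose vertices are all functions $V(B)\to V(H)$ (not only homomorphisms), with an edge between $f_1$ and $f_2$ (possibly $f_1=f_2$, giving a loop) if and only if for every ordered pair $(u,v)$ with $uv\in E(B)$, $f_1(u)f_2(v)\in E(H)$. For a graph $F$, $l(F)$ denotes the induced subgraph of $F$ on the set of looped vertices of $F$ (the loops are kept). *)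

theory Defs
  imports Complex_Main "HOL-Library.FuncSet" "Graph_Theory.Graph_Theory"
begin

text \<open>
  A finite undirected graph without multiple edges, possibly with loops, is a
  \<^locale>\<open>pair_pseudo_graph\<close>: the edge \<open>uv\<close> is the pair of arcs \<open>(u, v)\<close> and \<open>(v, u)\<close>, and a loop
  at \<open>v\<close> is the single arc \<open>(v, v)\<close>. A \<^locale>\<open>pair_graph\<close> is moreover loop-free, so that
  \<^const>\<open>out_degree\<close> is the usual vertex degree.
\<close>

text \<open>
  Homomorphisms are taken to be extensional outside \<open>verts G\<close>, so that their set is in bijection
  with the maps \<open>V(G) \<rightarrow> V(H)\<close> that preserve edges (in particular it is finite for finite graphs,
  and there is exactly one homomorphism from the null graph).
\<close>

definition graph_homs :: "('a, 'b) pre_digraph \<Rightarrow> ('c, 'd) pre_digraph \<Rightarrow> ('a \<Rightarrow> 'c) set" where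
  "graph_homs G H =
     {\<phi> \<in> verts G \<rightarrow>\<^sub>E verts H. \<forall>(u, v) \<in> arcs_ends G. (\<phi> u, \<phi> v) \<in> arcs_ends H}"

definition hom_count :: "('a, 'b) pre_digraph \<Rightarrow> ('c, 'd) pre_digraph \<Rightarrow> nat" where
  "hom_count G H = card (graph_homs G H)"

definition bipartite :: "'a pair_pre_digraph \<Rightarrow> bool" where
  "bipartite B \<longleftrightarrow>
     (\<exists>X Y. pverts B = X \<union> Y \<and> X \<inter> Y = {} \<and> parcs B \<subseteq> X \<times> Y \<union> Y \<times> X)"

text \<open>
  \<open>graph_exp H B\<close> is \<open>H\<^sup>B\<close>. Since \<open>parcs B\<close> is symmetric, the condition below ranges over both
  orientations of every edge of \<open>B\<close>.
\<close>

definition graph_exp :: "'h pair_pre_digraph \<Rightarrow> 'b pair_pre_digraph \<Rightarrow> ('b \<Rightarrow> 'h) pair_pre_digraph" where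
  "graph_exp H B =
     \<lparr>pverts = pverts B \<rightarrow>\<^sub>E pverts H,
      parcs = {(f\<^sub>1, f\<^sub>2). f\<^sub>1 \<in> pverts B \<rightarrow>\<^sub>E pverts H \<and> f\<^sub>2 \<in> pverts B \<rightarrow>\<^sub>E pverts H \<and>
                 (\<forall>(u, v) \<in> parcs B. (f\<^sub>1 u, f\<^sub>2 v) \<in> parcs H)}\<rparr>"

definition looped_subgraph :: "('a, 'b) pre_digraph \<Rightarrow> ('a, 'b) pre_digraph" where
  "looped_subgraph F = F \<restriction> {v \<in> verts F. (v, v) \<in> arcs_ends F}"

lemma pair_pseudo_graph_graph_exp:
  assumes "pair_pseudo_graph H" "pair_pseudo_graph B"
  shows "pair_pseudo_graph (graph_exp H B)"
proof -
  interpret H: pair_pseudo_graph H by fact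
  interpret B: pair_pseudo_graph B by fact
  let ?V = "pverts B \<rightarrow>\<^sub>E pverts H"
  have fin: "finite ?V"
    using B.pair_finite_verts H.pair_finite_verts by (simp add: finite_PiE)
  have sub: "parcs (graph_exp H B) \<subseteq> ?V \<times> ?V"
    unfolding graph_exp_def by auto
  have sym: "sym (parcs (graph_exp H B))"
  proof (rule symI)
    fix f g assume fg: "(f, g) \<in> parcs (graph_exp H B)"
    have "(g u, f v) \<in> parcs H" if "(u, v) \<in> parcs B" for u v
    proof -
      have "(f v, g u) \<in> parcs H"
        using fg B.arcs_symmetric[OF that] unfolding graph_exp_def by auto
      then show ?thesis by (rule H.arcs_symmetric)
    qed
    then show "(g, f) \<in> parcs (graph_exp H B)"
      using fg unfolding graph_exp_def by auto
  qed
  have finp: "finite (parcs (graph_exp H B))"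
    by (rule finite_subset[OF sub]) (simp add: fin)
  have V: "pverts (graph_exp H B) = ?V"
    by (simp add: graph_exp_def)
  show ?thesis
  proof
    fix e assume "e \<in> parcs (graph_exp H B)"
    then have "e \<in> ?V \<times> ?V" using sub by blast
    then show "fst e \<in> pverts (graph_exp H B)" "snd e \<in> pverts (graph_exp H B)"
      unfolding V by (simp_all add: mem_Times_iff)
  next
    show "finite (pverts (graph_exp H B))" unfolding V by (rule fin)
    show "finite (parcs (graph_exp H B))" by (rule finp)
    show "symmetric (with_proj (graph_exp H B))"
      unfolding symmetric_def with_proj_simps by (rule sym)
  qed
qed

text \<open>
  For \<open>x \<ge> 0\<close> the power \<open>x\<^bsup>n/k\<^esup>\<close> is written \<open>root k (x ^ n)\<close>. It agrees with \<^const>\<open>powr\<close>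
  except at \<open>x = 0\<close>, \<open>n = 0\<close>, where \<open>0 powr 0 = 0\<close> but the value \<open>0\<^sup>0 = 1\<close> is meant (the null graph
  as source and no homomorphism from the complete graph).
\<close>

lemma root_power_eq_powr:
  fixes x :: real
  assumes "x \<ge> 0" "k > 0" "x > 0 \<or> n > 0"
  shows "root k (x ^ n) = x powr (real n / real k)"
proof (cases "x = 0")
  case True
  then show ?thesis using assms by (simp add: power_0_left)
next
  case False
  with assms have "x > 0" by simp
  then have "root k (x ^ n) = (x powr real n) powr (1 / real k)"
    using assms by (simp add: root_powr_inverse powr_realpow)
  then show ?thesis by (simp add: powr_powr)
qed

end

theory Submission
  imports Defs "HOL-Analysis.Convex"
begin

text \<open>
  If \<open>B\<close> has parts \<open>X\<close> and \<open>Y\<close>, a homomorphism from \<open>G\<close> to \<open>l(H\<^sup>B)\<close> is a pair of maps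
  \<open>a : V(G) \<rightarrow> V(H)\<^sup>X\<close> and \<open>b : V(G) \<rightarrow> V(H)\<^sup>Y\<close> such that \<open>a u\<close> and \<open>b v\<close> are adjacent in a fixed
  bipartite relation whenever \<open>u\<close> lies in the closed neighbourhood \<open>N[v]\<close>; the loops of \<open>l(H\<^sup>B)\<close>
  account for the case \<open>u = v\<close>. Summing over \<open>b\<close> first gives
  \<open>\<Sum>\<^sub>a \<Prod>\<^sub>v c(a|N[v])\<close>, where \<open>c\<close> counts common neighbours. Every vertex lies in exactly \<open>d + 1\<close>
  closed neighbourhoods, so Finner's generalisation of Hoelder's inequality bounds this by
  \<open>\<Prod>\<^sub>v (\<Sum>\<^sub>a c(a)\<^bsup>d+1\<^esup>)\<^bsup>1/(d+1)\<^esup>\<close> with \<open>a\<close> ranging over the maps on \<open>N[v]\<close>. As \<open>|N[v]| = d + 1\<close>,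
  each inner sum is the same formula for \<open>K\<^bsub>d+1\<^esub>\<close>, in which all closed neighbourhoods are the whole
  vertex set.
\<close>

section \<open>Hoelder's inequality for finite sums with equal exponents\<close>

text \<open>The arithmetic-geometric mean inequality for the powers \<open>f i ^ card I\<close>,
  whose geometric mean is the product of the \<open>f i\<close>. It takes the place of Young's
  inequality in the proof of Hoelder's.\<close>

lemma prod_le_mean_power:
  fixes f :: "'i \<Rightarrow> real"
  assumes "finite I" "I \<noteq> {}" "\<And>i. i \<in> I \<Longrightarrow> f i \<ge> 0"
  shows "(\<Prod>i\<in>I. f i) \<le> (\<Sum>i\<in>I. f i ^ card I / card I)"
proof -
  have nonneg: "(\<Prod>i\<in>I. f i) \<ge> 0"
    using assms by (simp add: prod_nonneg)
  have D: "card I > 0"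
    using assms by (simp add: card_gt_0_iff)
  have "(\<Prod>i\<in>I. f i) = ((\<Prod>i\<in>I. f i) ^ card I) powr (1 / card I)"
    using nonneg D by (metis real_root_power_cancel root_powr_inverse zero_le_power)
  also have "\<dots> = (\<Prod>i\<in>I. f i ^ card I) powr (1 / card I)"
    by (simp add: prod_power_distrib)
  also have "\<dots> \<le> (\<Sum>i\<in>I. f i ^ card I / card I)"
    using assms by (intro arith_geom_mean) auto
  finally show ?thesis .
qed

text \<open>After scaling every \<open>f i\<close> to have \<open>card I\<close>-norm 1 over
  \<open>A\<close>, the pointwise mean bound sums to 1, each index contributing
  \<open>1 / card I\<close>.\<close>

lemma Holder_inequality_sum_prod:
  fixes f :: "'i \<Rightarrow> 'a \<Rightarrow> real"
  assumes "finite I" "I \<noteq> {}" "finite A" and nonneg: "\<And>i x. f i x \<ge> 0"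
  shows "(\<Sum>x\<in>A. \<Prod>i\<in>I. f i x) \<le> (\<Prod>i\<in>I. root (card I) (\<Sum>x\<in>A. f i x ^ card I))"
proof -
  let ?D = "card I"
  define s where "s i = (\<Sum>x\<in>A. f i x ^ ?D)" for i
  have D: "?D > 0"
    using assms by (simp add: card_gt_0_iff)
  have s_nonneg: "s i \<ge> 0" for i
    unfolding s_def by (simp add: sum_nonneg nonneg)
  show ?thesis
  \<comment> \<open>The scaling divides by the norms, so a vanishing norm is treated apart: that
    \<open>f i\<close> is zero on \<open>A\<close>, and hence so is the left-hand side.\<close>
  proof (cases "\<exists>i\<in>I. s i = 0")
    case True
    then obtain i where i: "i \<in> I" "s i = 0" by blast
    then have "f i x = 0" if "x \<in> A" for x
      using that \<open>finite A\<close> D unfolding s_def by (simp add: sum_nonneg_eq_0_iff nonneg)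
    then have "(\<Sum>x\<in>A. \<Prod>i\<in>I. f i x) = 0"
      using i(1) \<open>finite I\<close> by (intro sum.neutral) auto
    then show ?thesis
      using s_nonneg by (simp add: prod_nonneg real_root_ge_zero flip: s_def)
  next
    case False
    define r where "r i = root ?D (s i)" for i
    have s_pos: "s i > 0" if "i \<in> I" for i
      using False that s_nonneg[of i] by fastforce
    have r_pos: "r i > 0" if "i \<in> I" for i
      using s_pos[OF that] D by (simp add: r_def)
    have r_pow: "r i ^ ?D = s i" for i
      using s_nonneg D by (simp add: r_def)
    have "(\<Sum>x\<in>A. \<Prod>i\<in>I. f i x) = (\<Prod>i\<in>I. r i) * (\<Sum>x\<in>A. \<Prod>i\<in>I. f i x / r i)"
    proof -
      have "(\<Prod>i\<in>I. f i x) = (\<Prod>i\<in>I. r i) * (\<Prod>i\<in>I. f i x / r i)" for x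
        unfolding prod.distrib[symmetric] using r_pos by (intro prod.cong) (auto simp: less_le)
      then show ?thesis by (simp add: sum_distrib_left)
    qed
    also have "\<dots> \<le> (\<Prod>i\<in>I. r i) * 1"
    proof (intro mult_left_mono)
      have "(\<Sum>x\<in>A. \<Prod>i\<in>I. f i x / r i) \<le> (\<Sum>x\<in>A. \<Sum>i\<in>I. (f i x / r i) ^ ?D / ?D)"
        using assms r_pos by (intro sum_mono prod_le_mean_power) (auto intro: divide_nonneg_pos)
      also have "\<dots> = (\<Sum>i\<in>I. \<Sum>x\<in>A. f i x ^ ?D / s i / ?D)"
        by (subst sum.swap) (simp add: power_divide r_pow)
      also have "\<dots> = (\<Sum>i\<in>I. s i / s i / ?D)"
        by (simp only: s_def sum_divide_distrib)
      also have "\<dots> = (\<Sum>i\<in>I. 1 / ?D)"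
        using s_pos by (intro sum.cong) (auto simp: less_le)
      also have "\<dots> = 1"
        using D by simp
      finally show "(\<Sum>x\<in>A. \<Prod>i\<in>I. f i x / r i) \<le> 1" .
      show "(\<Prod>i\<in>I. r i) \<ge> 0"
        using r_pos by (intro prod_nonneg) (auto simp: less_le)
    qed
    finally show ?thesis
      by (simp add: r_def s_def)
  qed
qed

section \<open>Finner's inequality for uniform covers\<close>

lemma sum_PiE_insert:
  assumes "u \<notin> U"
  shows "(\<Sum>a\<in>insert u U \<rightarrow>\<^sub>E A. F a) = (\<Sum>a\<in>U \<rightarrow>\<^sub>E A. \<Sum>x\<in>A. F (a(u := x)))"
proof -
  have "(\<Sum>a\<in>insert u U \<rightarrow>\<^sub>E A. F a) = (\<Sum>(x, a)\<in>A \<times> (U \<rightarrow>\<^sub>E A). F (a(u := x)))"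
    unfolding PiE_insert_eq using assms
    by (subst sum.reindex[OF inj_combinator]) (auto intro!: sum.cong)
  also have "\<dots> = (\<Sum>x\<in>A. \<Sum>a\<in>U \<rightarrow>\<^sub>E A. F (a(u := x)))"
    by (rule sum.cartesian_product[symmetric])
  also have "\<dots> = (\<Sum>a\<in>U \<rightarrow>\<^sub>E A. \<Sum>x\<in>A. F (a(u := x)))"
    by (rule sum.swap)
  finally show ?thesis .
qed

text \<open>Induction on \<open>U\<close>: the coordinate \<open>u\<close> is summed out by Hoelder's inequality over the
  \<open>D\<close> factors that depend on it, which replaces each of them by its \<open>D\<close>-norm in that coordinate.\<close>

lemma Finner_inequality:
  fixes g :: "'w \<Rightarrow> ('u \<Rightarrow> 'a) \<Rightarrow> real"
  assumes "finite U" "finite W" "finite A" "D > 0"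
    and "\<And>w. w \<in> W \<Longrightarrow> N w \<subseteq> U"
    and "\<And>u. u \<in> U \<Longrightarrow> card {w \<in> W. u \<in> N w} = D"
    and "\<And>w a. g w a \<ge> 0"
  shows "(\<Sum>a\<in>U \<rightarrow>\<^sub>E A. \<Prod>w\<in>W. g w (restrict a (N w)))
    \<le> (\<Prod>w\<in>W. root D (\<Sum>a\<in>N w \<rightarrow>\<^sub>E A. g w a ^ D))"
  using assms(1,5-)
proof (induction U arbitrary: N g rule: finite_induct)
  case empty
  \<comment> \<open>Every \<open>N w\<close> is empty here and the only extensional map is
    constantly \<open>undefined\<close>, so both sides are the product of the values of
    \<open>g w\<close> at that map.\<close>
  then show ?case
    using \<open>D > 0\<close> by (auto simp: real_root_power_cancel restrict_def intro!: prod_mono)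
next
  case (insert u U)
  define N' where "N' w = N w - {u}" for w
  define W1 where "W1 = {w \<in> W. u \<in> N w}"
  define W2 where "W2 = {w \<in> W. u \<notin> N w}"
  have W: "W = W1 \<union> W2" "W1 \<inter> W2 = {}"
    by (auto simp: W1_def W2_def)
  have fin: "finite W1" "finite W2"
    using \<open>finite W\<close> by (auto simp: W1_def W2_def)
  have card_W1: "card W1 = D"
    using insert.prems(2) by (simp add: W1_def)
  define g' where
    "g' w a = (if u \<in> N w then root D (\<Sum>x\<in>A. g w (a(u := x)) ^ D) else g w a)" for w a
  have nonneg: "g' w a \<ge> 0" for w a
    using insert.prems(3) by (simp add: g'_def sum_nonneg real_root_ge_zero)
  have prod_W: "(\<Prod>w\<in>W. h w) = (\<Prod>w\<in>W2. h w) * (\<Prod>w\<in>W1. h w)" for h :: "'w \<Rightarrow> real"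
    unfolding W(1) using fin W(2) by (subst prod.union_disjoint) (auto simp: mult.commute)
  have "(\<Sum>a\<in>insert u U \<rightarrow>\<^sub>E A. \<Prod>w\<in>W. g w (restrict a (N w)))
      = (\<Sum>a\<in>U \<rightarrow>\<^sub>E A. \<Sum>x\<in>A. \<Prod>w\<in>W. g w (restrict (a(u := x)) (N w)))"
    using insert.hyps by (simp add: sum_PiE_insert)
  \<comment> \<open>The factors in \<open>W2\<close> ignore the coordinate \<open>u\<close> and
    leave the inner sum. Exactly \<open>D\<close> factors remain in it, which is why Hoelder's
    exponent will be \<open>D\<close>.\<close>
  also have "\<dots> = (\<Sum>a\<in>U \<rightarrow>\<^sub>E A. (\<Prod>w\<in>W2. g' w (restrict a (N' w))) *
      (\<Sum>x\<in>A. \<Prod>w\<in>W1. g w ((restrict a (N' w))(u := x))))"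
  proof -
    have "restrict (a(u := x)) (N w) = (restrict a (N' w))(u := x)" if "w \<in> W1" for a :: "'u \<Rightarrow> 'a" and x w
      using that by (auto simp: W1_def N'_def restrict_def)
    moreover have "g w (restrict (a(u := x)) (N w)) = g' w (restrict a (N' w))" if "w \<in> W2" for a x w
    proof -
      have "restrict (a(u := x)) (N w) = restrict a (N' w)"
        using that by (auto simp: W2_def N'_def restrict_def)
      then show ?thesis
        using that by (simp add: W2_def g'_def)
    qed
    ultimately show ?thesis
      by (simp add: prod_W sum_distrib_left)
  qed
  also have "\<dots> \<le> (\<Sum>a\<in>U \<rightarrow>\<^sub>E A. (\<Prod>w\<in>W2. g' w (restrict a (N' w))) *
      (\<Prod>w\<in>W1. g' w (restrict a (N' w))))"
  proof (intro sum_mono mult_left_mono)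
    fix a :: "'u \<Rightarrow> 'a"
    have "W1 \<noteq> {}"
      using card_W1 \<open>D > 0\<close> by auto
    then have "(\<Sum>x\<in>A. \<Prod>w\<in>W1. g w ((restrict a (N' w))(u := x)))
        \<le> (\<Prod>w\<in>W1. root D (\<Sum>x\<in>A. g w ((restrict a (N' w))(u := x)) ^ D))"
      using Holder_inequality_sum_prod[OF fin(1) _ \<open>finite A\<close>,
          of "\<lambda>w x. g w ((restrict a (N' w))(u := x))"] insert.prems(3) card_W1 by simp
    also have "\<dots> = (\<Prod>w\<in>W1. g' w (restrict a (N' w)))"
      by (intro prod.cong) (auto simp: g'_def W1_def)
    finally show "(\<Sum>x\<in>A. \<Prod>w\<in>W1. g w ((restrict a (N' w))(u := x)))
        \<le> (\<Prod>w\<in>W1. g' w (restrict a (N' w)))" .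
  qed (simp add: prod_nonneg nonneg)
  also have "\<dots> = (\<Sum>a\<in>U \<rightarrow>\<^sub>E A. \<Prod>w\<in>W. g' w (restrict a (N' w)))"
    by (simp add: prod_W)
  also have "\<dots> \<le> (\<Prod>w\<in>W. root D (\<Sum>a\<in>N' w \<rightarrow>\<^sub>E A. g' w a ^ D))"
  proof (rule insert.IH)
    show "N' w \<subseteq> U" if "w \<in> W" for w
      using insert.prems(1)[OF that] by (auto simp: N'_def)
    \<comment> \<open>Deleting \<open>u\<close> from the sets does not change how often any other
      coordinate is covered.\<close>
    show "card {w \<in> W. v \<in> N' w} = D" if "v \<in> U" for v
    proof -
      have "{w \<in> W. v \<in> N' w} = {w \<in> W. v \<in> N w}"
        using that insert.hyps by (auto simp: N'_def)
      then show ?thesis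
        using insert.prems(2) that by simp
    qed
  qed (rule nonneg)
  also have "\<dots> = (\<Prod>w\<in>W. root D (\<Sum>a\<in>N w \<rightarrow>\<^sub>E A. g w a ^ D))"
  proof (intro prod.cong arg_cong[of _ _ "root D"] refl)
    fix w
    show "(\<Sum>a\<in>N' w \<rightarrow>\<^sub>E A. g' w a ^ D) = (\<Sum>a\<in>N w \<rightarrow>\<^sub>E A. g w a ^ D)"
    proof (cases "u \<in> N w")
      case True
      then have "N w = insert u (N' w)" "u \<notin> N' w"
        by (auto simp: N'_def)
      \<comment> \<open>The \<open>D\<close>-th power undoes the root in \<open>g'\<close>, and the
        two nested sums merge into one over the maps on \<open>N w\<close>.\<close>
      then show ?thesis
        using True \<open>D > 0\<close> insert.prems(3) by (simp add: sum_PiE_insert g'_def sum_nonneg)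
    qed (simp add: N'_def g'_def)
  qed
  finally show ?case .
qed

section \<open>Common neighbours in a bipartite relation\<close>

definition common_nbrs :: "('p \<Rightarrow> 'q \<Rightarrow> bool) \<Rightarrow> 'q set \<Rightarrow> 'u set \<Rightarrow> ('u \<Rightarrow> 'p) \<Rightarrow> 'q set" where
  "common_nbrs R Q S a = {q \<in> Q. \<forall>u\<in>S. R (a u) q}"

text \<open>A bijection from \<open>S\<close> to \<open>T\<close> relabels the coordinates without
  changing the set of common neighbours. This allows a closed neighbourhood to be exchanged for the
  vertex set of the complete graph.\<close>

lemma sum_common_nbrs_cong_card:
  assumes "finite S" "finite T" "card S = card T"
  shows "(\<Sum>a\<in>S \<rightarrow>\<^sub>E P. card (common_nbrs R Q S a) ^ D)
    = (\<Sum>a\<in>T \<rightarrow>\<^sub>E P. card (common_nbrs R Q T a) ^ D)"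
proof -
  obtain \<pi> where \<pi>: "bij_betw \<pi> S T"
    using assms finite_same_card_bij by blast
  define \<sigma> where "\<sigma> = inv_into S \<pi>"
  have \<sigma>: "bij_betw \<sigma> T S"
    using \<pi> by (simp add: \<sigma>_def bij_betw_inv_into)
  have inv: "\<sigma> (\<pi> s) = s" if "s \<in> S" for s
    using \<pi> that by (simp add: \<sigma>_def bij_betw_inv_into_left)
  have inv': "\<pi> (\<sigma> t) = t" if "t \<in> T" for t
    using \<pi> that by (simp add: \<sigma>_def bij_betw_inv_into_right)
  note maps = bij_betwE[OF \<pi>] bij_betwE[OF \<sigma>]
  show ?thesis
  proof (rule sum.reindex_bij_witness[where i = "\<lambda>b. restrict (b \<circ> \<pi>) S" and j = "\<lambda>a. restrict (a \<circ> \<sigma>) T"])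
    fix a assume a: "a \<in> S \<rightarrow>\<^sub>E P"
    show "restrict (restrict (a \<circ> \<sigma>) T \<circ> \<pi>) S = a"
      using a maps inv by (auto simp: fun_eq_iff restrict_def PiE_def extensional_def)
    show "restrict (a \<circ> \<sigma>) T \<in> T \<rightarrow>\<^sub>E P"
      using a maps by auto
    have "(\<forall>u\<in>T. R (restrict (a \<circ> \<sigma>) T u) q) \<longleftrightarrow> (\<forall>u\<in>S. R (a u) q)" for q
      using maps inv inv' by (auto, metis)
    then show "card (common_nbrs R Q T (restrict (a \<circ> \<sigma>) T)) ^ D = card (common_nbrs R Q S a) ^ D"
      by (simp add: common_nbrs_def)
  next
    fix b assume b: "b \<in> T \<rightarrow>\<^sub>E P"
    show "restrict (restrict (b \<circ> \<pi>) S \<circ> \<sigma>) T = b"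
      using b maps inv' by (auto simp: fun_eq_iff restrict_def PiE_def extensional_def)
    show "restrict (b \<circ> \<pi>) S \<in> S \<rightarrow>\<^sub>E P"
      using b maps by auto
  qed
qed

section \<open>Homomorphisms into the looped part of the exponential graph\<close>

text \<open>With \<open>X\<close> and \<open>Y\<close> the parts of \<open>B\<close>, this is the
  fixed bipartite relation between maps on \<open>X\<close> and maps on \<open>Y\<close>; each edge
  of \<open>B\<close> is read once, starting from \<open>X\<close>.\<close>

definition side_adj ::
    "'h pair_pre_digraph \<Rightarrow> 'b pair_pre_digraph \<Rightarrow> 'b set \<Rightarrow> ('b \<Rightarrow> 'h) \<Rightarrow> ('b \<Rightarrow> 'h) \<Rightarrow> bool" where
  "side_adj H B X p q \<longleftrightarrow> (\<forall>(x, y) \<in> parcs B. x \<in> X \<longrightarrow> (p x, q y) \<in> parcs H)"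

text \<open>Arcs of \<open>B\<close> leaving \<open>X\<close> give the first conjunct; those leaving
  \<open>Y\<close>, reversed by the symmetry of \<open>B\<close> and \<open>H\<close>, give the
  second. For \<open>f = g\<close> the conjuncts coincide, so a loop amounts to a single
  condition.\<close>

lemma graph_exp_adj_iff_side_adj:
  assumes H: "pair_pseudo_graph H" and B: "pair_pseudo_graph B"
    and disj: "X \<inter> Y = {}" and bip: "parcs B \<subseteq> X \<times> Y \<union> Y \<times> X"
  shows "(\<forall>(u, v) \<in> parcs B. (f u, g v) \<in> parcs H) \<longleftrightarrow>
    side_adj H B X (restrict f X) (restrict g Y) \<and> side_adj H B X (restrict g X) (restrict f Y)"
proof -
  interpret H: pair_pseudo_graph H by fact
  interpret B: pair_pseudo_graph B by fact
  \<comment> \<open>An arc of \<open>B\<close> that starts in \<open>X\<close> ends in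
    \<open>Y\<close>, so the restrictions have no effect.\<close>
  have side: "side_adj H B X (restrict p X) (restrict q Y) \<longleftrightarrow>
      (\<forall>(x, y) \<in> parcs B. x \<in> X \<longrightarrow> (p x, q y) \<in> parcs H)" for p q
    unfolding side_adj_def using disj bip by fastforce
  show ?thesis
    unfolding side
  proof (intro iffI conjI)
    assume *: "\<forall>(u, v) \<in> parcs B. (f u, g v) \<in> parcs H"
    then show "\<forall>(x, y) \<in> parcs B. x \<in> X \<longrightarrow> (f x, g y) \<in> parcs H" by blast
    show "\<forall>(x, y) \<in> parcs B. x \<in> X \<longrightarrow> (g x, f y) \<in> parcs H"
      using * B.arcs_symmetric H.arcs_symmetric by blast
  next
    assume *: "(\<forall>(x, y) \<in> parcs B. x \<in> X \<longrightarrow> (f x, g y) \<in> parcs H) \<and>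
      (\<forall>(x, y) \<in> parcs B. x \<in> X \<longrightarrow> (g x, f y) \<in> parcs H)"
    have "(f u, g v) \<in> parcs H" if "(u, v) \<in> parcs B" for u v
    proof (cases "u \<in> X")
      case True
      with * that show ?thesis by blast
    next
      case False
      with that bip have "v \<in> X" by auto
      with * B.arcs_symmetric[OF that] have "(g v, f u) \<in> parcs H" by blast
      then show ?thesis by (rule H.arcs_symmetric)
    qed
    then show "\<forall>(u, v) \<in> parcs B. (f u, g v) \<in> parcs H" by blast
  qed
qed

lemma verts_looped_graph_exp:
  "verts (looped_subgraph (with_proj (graph_exp H B))) =
     {f \<in> pverts B \<rightarrow>\<^sub>E pverts H. \<forall>(u, v) \<in> parcs B. (f u, f v) \<in> parcs H}"
  by (auto simp: looped_subgraph_def graph_exp_def)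

lemma arcs_ends_looped_graph_exp:
  "(f, g) \<in> arcs_ends (looped_subgraph (with_proj (graph_exp H B))) \<longleftrightarrow>
     f \<in> verts (looped_subgraph (with_proj (graph_exp H B))) \<and>
     g \<in> verts (looped_subgraph (with_proj (graph_exp H B))) \<and>
     (\<forall>(u, v) \<in> parcs B. (f u, g v) \<in> parcs H)"
  unfolding verts_looped_graph_exp
  by (auto simp: looped_subgraph_def graph_exp_def arcs_ends_conv image_iff)

definition closed_nbhd :: "('a, 'b) pre_digraph \<Rightarrow> 'a \<Rightarrow> 'a set" where
  "closed_nbhd G v = insert v {u. (u, v) \<in> arcs_ends G}"

text \<open>Once the halves \<open>a\<close> on \<open>X\<close> are chosen, the condition on the
  half at \<open>v\<close> on \<open>Y\<close> involves only \<open>a\<close> on the closed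
  neighbourhood of \<open>v\<close>. The choices at different vertices are thus independent, which
  yields the product.\<close>

lemma hom_count_looped_graph_exp:
  fixes G :: "('a, 'e) pre_digraph" and H :: "'h pair_pre_digraph" and B :: "'b pair_pre_digraph"
  assumes H: "pair_pseudo_graph H" and B: "pair_pseudo_graph B"
    and XY: "pverts B = X \<union> Y" and disj: "X \<inter> Y = {}" and bip: "parcs B \<subseteq> X \<times> Y \<union> Y \<times> X"
    and G: "wf_digraph G" "finite (verts G)" "symmetric G"
  shows "hom_count G (looped_subgraph (with_proj (graph_exp H B))) =
    (\<Sum>a\<in>verts G \<rightarrow>\<^sub>E (X \<rightarrow>\<^sub>E pverts H). \<Prod>v\<in>verts G.
       card (common_nbrs (side_adj H B X) (Y \<rightarrow>\<^sub>E pverts H) (closed_nbhd G v) a))"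
proof -
  interpret H: pair_pseudo_graph H by fact
  interpret B: pair_pseudo_graph B by fact
  interpret G: wf_digraph G by fact
  let ?V = "verts G" and ?L = "looped_subgraph (with_proj (graph_exp H B))"
  let ?P = "X \<rightarrow>\<^sub>E pverts H" and ?Q = "Y \<rightarrow>\<^sub>E pverts H" and ?R = "side_adj H B X"
  let ?C = "\<lambda>a v. common_nbrs ?R ?Q (closed_nbhd G v) a"
  have finXY: "finite X" "finite Y"
    using B.pair_finite_verts XY by auto
  have finP: "finite ?P" and finQ: "finite ?Q"
    using finXY H.pair_finite_verts by (auto intro!: finite_PiE)
  have adj: "(f, g) \<in> arcs_ends ?L \<longleftrightarrow> f \<in> verts ?L \<and> g \<in> verts ?L \<and>
      ?R (restrict f X) (restrict g Y) \<and> ?R (restrict g X) (restrict f Y)" for f g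
    unfolding arcs_ends_looped_graph_exp graph_exp_adj_iff_side_adj[OF H B disj bip] by blast
  have vert: "f \<in> verts ?L \<longleftrightarrow> f \<in> X \<union> Y \<rightarrow>\<^sub>E pverts H \<and> ?R (restrict f X) (restrict f Y)" for f
    unfolding verts_looped_graph_exp
    by (simp add: graph_exp_adj_iff_side_adj[OF H B disj bip] XY)
  \<comment> \<open>The case \<open>u = v\<close> says that \<open>\<phi> v\<close> is looped. For
    an edge, the two conjuncts of \<open>adj\<close> come from its two orientations.\<close>
  have homs: "\<phi> \<in> graph_homs G ?L \<longleftrightarrow> \<phi> \<in> ?V \<rightarrow>\<^sub>E (X \<union> Y \<rightarrow>\<^sub>E pverts H) \<and>
      (\<forall>v\<in>?V. \<forall>u\<in>closed_nbhd G v. ?R (restrict (\<phi> u) X) (restrict (\<phi> v) Y))" for \<phi>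
  proof
    assume "\<phi> \<in> graph_homs G ?L"
    then have \<phi>: "\<phi> \<in> ?V \<rightarrow>\<^sub>E verts ?L" and
      arcs: "\<And>u v. (u, v) \<in> arcs_ends G \<Longrightarrow> (\<phi> u, \<phi> v) \<in> arcs_ends ?L"
      by (auto simp: graph_homs_def)
    then show "\<phi> \<in> ?V \<rightarrow>\<^sub>E (X \<union> Y \<rightarrow>\<^sub>E pverts H) \<and>
      (\<forall>v\<in>?V. \<forall>u\<in>closed_nbhd G v. ?R (restrict (\<phi> u) X) (restrict (\<phi> v) Y))"
      unfolding closed_nbhd_def adj vert PiE_iff by auto
  next
    assume *: "\<phi> \<in> ?V \<rightarrow>\<^sub>E (X \<union> Y \<rightarrow>\<^sub>E pverts H) \<and>
      (\<forall>v\<in>?V. \<forall>u\<in>closed_nbhd G v. ?R (restrict (\<phi> u) X) (restrict (\<phi> v) Y))"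
    then have V: "\<phi> v \<in> verts ?L" if "v \<in> ?V" for v
      using that unfolding vert closed_nbhd_def by (auto simp: PiE_iff)
    have "(\<phi> u, \<phi> v) \<in> arcs_ends ?L" if uv: "(u, v) \<in> arcs_ends G" for u v
    proof -
      have "(v, u) \<in> arcs_ends G"
        using uv \<open>symmetric G\<close> by (auto simp: symmetric_def dest: symD)
      moreover have "u \<in> ?V" "v \<in> ?V"
        using uv by auto
      ultimately show ?thesis
        using * uv V unfolding adj closed_nbhd_def by auto
    qed
    with * V show "\<phi> \<in> graph_homs G ?L"
      by (auto simp: graph_homs_def PiE_iff)
  qed
  have nbhd: "closed_nbhd G v \<subseteq> ?V" if "v \<in> ?V" for v
    using that by (auto simp: closed_nbhd_def)
  define split where "split \<phi> = (\<lambda>u\<in>?V. restrict (\<phi> u) X, \<lambda>u\<in>?V. restrict (\<phi> u) Y)"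
    for \<phi> :: "'a \<Rightarrow> 'b \<Rightarrow> 'h"
  \<comment> \<open>The inverse of \<open>split\<close>; both abstractions are restricted so that
    the result is extensional on \<open>?V\<close> and on \<open>X \<union> Y\<close>.\<close>
  define join where "join = (\<lambda>(a :: 'a \<Rightarrow> 'b \<Rightarrow> 'h, b). \<lambda>u\<in>?V. \<lambda>x\<in>X \<union> Y. if x \<in> X then a u x else b u x)"
  have bQ: "b \<in> ?V \<rightarrow>\<^sub>E ?Q" if "b \<in> PiE ?V (?C a)" for a b
    using that by (auto simp: PiE_iff common_nbrs_def)
  have joinX: "restrict (join (a, b) u) X = a u" if "a \<in> ?V \<rightarrow>\<^sub>E ?P" "u \<in> ?V" for a b u
  proof -
    have "restrict (join (a, b) u) X = restrict (a u) X"
      using that(2) by (simp add: join_def cong: restrict_cong)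
    also have "\<dots> = a u"
      using that by (intro PiE_restrict) auto
    finally show ?thesis .
  qed
  have joinY: "restrict (join (a, b) u) Y = b u" if "b \<in> ?V \<rightarrow>\<^sub>E ?Q" "u \<in> ?V" for a b u
  proof -
    have "x \<notin> X" if "x \<in> Y" for x
      using disj that by blast
    then have "restrict (join (a, b) u) Y = restrict (b u) Y"
      using that(2) by (simp add: join_def cong: restrict_cong)
    also have "\<dots> = b u"
      using that by (intro PiE_restrict) auto
    finally show ?thesis .
  qed
  have "bij_betw split (graph_homs G ?L) (SIGMA a:?V \<rightarrow>\<^sub>E ?P. PiE ?V (?C a))"
  proof (rule bij_betw_byWitness[where f' = join])
    show "\<forall>\<phi>\<in>graph_homs G ?L. join (split \<phi>) = \<phi>"
    proof
      fix \<phi> assume "\<phi> \<in> graph_homs G ?L"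
      then have \<phi>: "\<phi> \<in> ?V \<rightarrow>\<^sub>E (X \<union> Y \<rightarrow>\<^sub>E pverts H)"
        unfolding homs by blast
      show "join (split \<phi>) = \<phi>"
      proof
        fix u
        show "join (split \<phi>) u = \<phi> u"
        proof (cases "u \<in> ?V")
          case True
          then have "join (split \<phi>) u = restrict (\<phi> u) (X \<union> Y)"
            by (auto simp: join_def split_def restrict_def fun_eq_iff)
          also have "\<dots> = \<phi> u"
            using \<phi> True by (intro PiE_restrict) auto
          finally show ?thesis .
        next
          case False
          then show ?thesis
            by (simp add: join_def split_def PiE_arb[OF \<phi>])
        qed
      qed
    qed
    show "\<forall>ab\<in>(SIGMA a:?V \<rightarrow>\<^sub>E ?P. PiE ?V (?C a)). split (join ab) = ab"
    proof clarify
      fix a b assume a: "a \<in> ?V \<rightarrow>\<^sub>E ?P" and b: "b \<in> PiE ?V (?C a)"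
      show "split (join (a, b)) = (a, b)"
        using a bQ[OF b] by (simp add: split_def joinX joinY PiE_restrict cong: restrict_cong)
    qed
    show "split ` graph_homs G ?L \<subseteq> (SIGMA a:?V \<rightarrow>\<^sub>E ?P. PiE ?V (?C a))"
    proof
      fix ab assume "ab \<in> split ` graph_homs G ?L"
      then obtain \<phi> where \<phi>: "\<phi> \<in> graph_homs G ?L" and ab: "ab = split \<phi>"
        by blast
      have restr: "restrict (\<phi> u) X \<in> ?P" "restrict (\<phi> u) Y \<in> ?Q" if "u \<in> ?V" for u
        using \<phi> that unfolding homs by (auto simp: PiE_iff)
      have "restrict (\<phi> v) Y \<in> ?C (\<lambda>u\<in>?V. restrict (\<phi> u) X) v" if v: "v \<in> ?V" for v
        unfolding common_nbrs_def
      proof (intro CollectI conjI ballI)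
        fix u assume u: "u \<in> closed_nbhd G v"
        then have "u \<in> ?V"
          using nbhd[OF v] by blast
        then show "?R ((\<lambda>u\<in>?V. restrict (\<phi> u) X) u) (restrict (\<phi> v) Y)"
          using \<phi> u v unfolding homs by simp
      qed (rule restr(2)[OF v])
      then show "ab \<in> (SIGMA a:?V \<rightarrow>\<^sub>E ?P. PiE ?V (?C a))"
        unfolding ab split_def using restr(1) by (simp add: restrict_PiE_iff)
    qed
    show "join ` (SIGMA a:?V \<rightarrow>\<^sub>E ?P. PiE ?V (?C a)) \<subseteq> graph_homs G ?L"
    proof clarify
      fix a b assume a: "a \<in> ?V \<rightarrow>\<^sub>E ?P" and b: "b \<in> PiE ?V (?C a)"
      have "a u x \<in> pverts H" if "u \<in> ?V" "x \<in> X" for u x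
        using a that by (auto dest: PiE_mem)
      moreover have "b u x \<in> pverts H" if "u \<in> ?V" "x \<in> Y" for u x
        using bQ[OF b] that by (auto dest: PiE_mem)
      ultimately have "join (a, b) \<in> ?V \<rightarrow>\<^sub>E (X \<union> Y \<rightarrow>\<^sub>E pverts H)"
        by (auto simp: join_def)
      moreover have "?R (restrict (join (a, b) u) X) (restrict (join (a, b) v) Y)"
        if v: "v \<in> ?V" and u: "u \<in> closed_nbhd G v" for u v
      proof -
        have "u \<in> ?V"
          using nbhd u v by blast
        moreover have "b v \<in> ?C a v"
          using b v by (rule PiE_mem)
        ultimately show ?thesis
          using u by (simp add: joinX[OF a] joinY[OF bQ[OF b] v] common_nbrs_def)
      qed
      ultimately show "join (a, b) \<in> graph_homs G ?L"
        unfolding homs by blast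
    qed
  qed
  then have "hom_count G ?L = card (SIGMA a:?V \<rightarrow>\<^sub>E ?P. PiE ?V (?C a))"
    unfolding hom_count_def by (rule bij_betw_same_card)
  also have "\<dots> = (\<Sum>a\<in>?V \<rightarrow>\<^sub>E ?P. card (PiE ?V (?C a)))"
    using G(2) finP finQ by (simp add: card_SigmaI finite_PiE common_nbrs_def)
  also have "\<dots> = (\<Sum>a\<in>?V \<rightarrow>\<^sub>E ?P. \<Prod>v\<in>?V. card (?C a v))"
    using G(2) by (simp add: card_PiE)
  finally show ?thesis .

qed

section \<open>Comparison of a regular graph with the complete graph\<close>

theorem theorem3:
  fixes G :: "'g pair_pre_digraph" and H :: "'h pair_pre_digraph" and B :: "'b pair_pre_digraph"
    and K :: "('k, 'l) pre_digraph" and n d :: nat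
  assumes "pair_graph G"
    and "card (pverts G) = n"
    and "\<forall>v \<in> pverts G. out_degree (with_proj G) v = d"
    and "pair_pseudo_graph H"
    and "pair_pseudo_graph B" and "bipartite B"
    and "complete_digraph (d + 1) K"
  shows "real (hom_count (with_proj G) (looped_subgraph (with_proj (graph_exp H B))))
    \<le> root (d + 1) (real (hom_count K (looped_subgraph (with_proj (graph_exp H B)))) ^ n)"
proof -
  interpret G: pair_graph G by fact
  interpret H: pair_pseudo_graph H by fact
  interpret B: pair_pseudo_graph B by fact
  interpret K: graph K
    using assms(7) by (simp add: complete_digraph_def)
  let ?L = "looped_subgraph (with_proj (graph_exp H B))" and ?V = "pverts G" and ?D = "d + 1"
  obtain X Y where XY: "pverts B = X \<union> Y" "X \<inter> Y = {}" "parcs B \<subseteq> X \<times> Y \<union> Y \<times> X"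
    using assms(6) unfolding bipartite_def by blast
  let ?P = "X \<rightarrow>\<^sub>E pverts H" and ?R = "side_adj H B X" and ?Q = "Y \<rightarrow>\<^sub>E pverts H"
  define N where "N = closed_nbhd (with_proj G)"
  note count = hom_count_looped_graph_exp[OF assms(4,5) XY]
  have finP: "finite ?P"
    using B.pair_finite_verts H.pair_finite_verts XY(1) by (auto intro!: finite_PiE)
  have N_sub: "N v \<subseteq> ?V" if "v \<in> ?V" for v
    using that by (auto simp: N_def closed_nbhd_def dest: G.in_arcsD1)
  have N_sym: "u \<in> N v \<longleftrightarrow> v \<in> N u" for u v
    using G.arcs_symmetric by (auto simp: N_def closed_nbhd_def)
  have card_N: "card (N v) = ?D" if v: "v \<in> ?V" for v
  proof -
    \<comment> \<open>\<open>out_degree\<close> counts arcs leaving \<open>v\<close>, whereas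
      \<open>closed_nbhd\<close> collects the tails of arcs entering it; symmetry identifies the
      two.\<close>
    have "(u, v) \<in> parcs G \<longleftrightarrow> (v, u) \<in> parcs G" for u
      using G.arcs_symmetric by blast
    then have "snd ` out_arcs (with_proj G) v = {u. (u, v) \<in> parcs G}"
      by (force simp: out_arcs_def image_iff)
    moreover have "inj_on snd (out_arcs (with_proj G) v)"
      by (auto simp: inj_on_def out_arcs_def)
    ultimately have "card {u. (u, v) \<in> parcs G} = d"
      using assms(3) v card_image unfolding out_degree_def by metis
    \<comment> \<open>Loop-freeness makes \<open>v\<close> itself a new element, which turns
      \<open>d\<close> into \<open>d + 1\<close>.\<close>
    moreover have "v \<notin> {u. (u, v) \<in> parcs G}"
      using G.pair_no_loops by fastforce
    moreover have "finite {u. (u, v) \<in> parcs G}"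
      by (rule finite_subset[OF _ G.pair_finite_verts]) (auto dest: G.in_arcsD1)
    ultimately show ?thesis
      by (simp add: N_def closed_nbhd_def)
  qed
  have card_V: "card (verts K) = ?D"
    using assms(7) by (simp add: complete_digraph_def)
  have "closed_nbhd K v = verts K" if "v \<in> verts K" for v
    using assms(7) that by (auto simp: closed_nbhd_def complete_digraph_def)
  then have K_count: "hom_count K ?L =
      (\<Sum>a\<in>verts K \<rightarrow>\<^sub>E ?P. card (common_nbrs ?R ?Q (verts K) a) ^ ?D)"
    by (subst count) (simp_all add: card_V K.wf_digraph_axioms K.sym_arcs)
  \<comment> \<open>The factor at \<open>v\<close> reads \<open>a\<close> only on
    \<open>N v\<close>, as the form of Finner's inequality demands.\<close>
  have restrict: "common_nbrs ?R ?Q S (restrict a S) = common_nbrs ?R ?Q S a" for S :: "'g set" and a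
    by (simp add: common_nbrs_def)
  have "real (hom_count (with_proj G) ?L) = (\<Sum>a\<in>?V \<rightarrow>\<^sub>E ?P. \<Prod>v\<in>?V.
      real (card (common_nbrs ?R ?Q (N v) (restrict a (N v)))))"
    unfolding restrict N_def
    by (subst count) (simp_all add: G.wf_digraph_axioms G.pair_sym_arcs)
  also have "\<dots> \<le> (\<Prod>v\<in>?V. root ?D (\<Sum>a\<in>N v \<rightarrow>\<^sub>E ?P. real (card (common_nbrs ?R ?Q (N v) a)) ^ ?D))"
  proof (rule Finner_inequality)
    \<comment> \<open>By symmetry, the closed neighbourhoods containing \<open>u\<close> are those
      centred at the members of \<open>N u\<close>.\<close>
    show "card {v \<in> ?V. u \<in> N v} = ?D" if "u \<in> ?V" for u
    proof -
      have "{v \<in> ?V. u \<in> N v} = N u"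
        using N_sub[OF that] N_sym by blast
      then show ?thesis
        using card_N[OF that] by simp
    qed
  qed (use finP N_sub in auto)
  also have "\<dots> = (\<Prod>v\<in>?V. root ?D (real (hom_count K ?L)))"
  proof (intro prod.cong refl arg_cong[of _ _ "root ?D"])
    fix v assume v: "v \<in> ?V"
    \<comment> \<open>An infinite set would have \<open>card\<close> equal to 0, not
      \<open>d + 1\<close>.\<close>
    have "finite (N v)"
      using card_N[OF v] card.infinite by fastforce
    then have "(\<Sum>a\<in>N v \<rightarrow>\<^sub>E ?P. card (common_nbrs ?R ?Q (N v) a) ^ ?D) = hom_count K ?L"
      unfolding K_count using card_N[OF v] card_V by (intro sum_common_nbrs_cong_card) auto
    then show "(\<Sum>a\<in>N v \<rightarrow>\<^sub>E ?P. real (card (common_nbrs ?R ?Q (N v) a)) ^ ?D) = real (hom_count K ?L)"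
      by (metis (mono_tags, lifting) of_nat_power of_nat_sum sum.cong)
  qed
  \<comment> \<open>The \<open>n\<close> equal roots combine into one; for the null graph both sides
    are 1.\<close>
  also have "\<dots> = root ?D (real (hom_count K ?L) ^ n)"
    using assms(2) by (simp add: real_root_power)
  finally show ?thesis .
qed

end
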